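(* Let $W$ be a function on $\overline{\mathbb{C}_+}$ of the form $$W(z)= e^{Az+C+\frac{A_0}{z}}\, z^{B}\,\frac{\prod_{\nu>0} \left(1+\frac{z}{a_\nu}\right)^{\kappa_\nu}}{\prod_{\mu>0} \left(1-\frac{z}{b_\mu}\right)^{\lambda_\mu}}\cdot\frac{\prod_{\nu>0} \left(1+\frac{1}{zc_\nu}\right)^{\widetilde\kappa_\nu}}{\prod_{\mu>0} \left(1-\frac{1}{zd_\mu}\right)^{\widetilde\lambda_\mu}},$$ where $C\in\mathbb{C}$, $B\in\mathbb{R}$, $A,A_0\ge 0$, and $a_\nu,b_\mu,c_\nu,d_\mu,\kappa_\nu,\lambda_\mu,\widetilde\kappa_\nu,\widetilde\lambda_\mu$ are positive reals, and suppose $W(z)\not\equiv e^Cz^B$. Then for any $\alpha\in\mathbb{C}\setminus\{0\}$ the $\alpha$-points of $W$ inside $\mathbb{C}_+$ (if they exist) are simple and distinct in absolute value from all other solutions of $|W(z)|=|\alpha|$ lying in $\overline{\mathbb{C}_+}$. The $\alpha$-points of $W$ on the real line (except at $0$) are either simple or double.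
   Context: $\mathbb{C}_+=\{z:\Im z>0\}$. An $\alpha$-point of $f$ is a $z_*$ with $f(z_* )=\alpha$; it has multiplicity $n$ if $f'(z_* )=\dots=f^{(n-1)}(z_* )=0\ne f^{(n)}(z_* )$; simple means multiplicity $1$, double means multiplicity $2$. The products are finite, infinite or empty and absolutely convergent ($\sum\kappa_\nu/a_\nu$, $\sum\lambda_\mu/b_\mu$, $\sum\widetilde\kappa_\nu/c_\nu$, $\sum\widetilde\lambda_\mu/d_\mu<\infty$), and each of the sequences $(a_\nu),(b_\mu),(c_\nu),(d_\mu)$ is finite or tends to $+\infty$. $W$ is a fixed single-valued holomorphic branch in $\mathbb{C}_+$, extended from $\mathbb{C}_+$ to the real points at which it is finite; near every real $\alpha$-point $x\neq0$ (with $\alpha\ne0$) it continues analytically to a full neighbourhood, which gives meaning to multiplicity there. *)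

theory Defs
  imports "HOL-Analysis.Analysis" "HOL-Complex_Analysis.Complex_Analysis" "HOL-Library.Extended_Nat"
begin

definition upper_halfplane :: "complex set" where
  "upper_halfplane = {z. Im z > 0}"

text \<open>
  A finite, infinite or empty sequence is a function on the naturals together with a length
  \<^term>\<open>N :: enat\<close>; only the entries at indices \<^term>\<open>n\<close> with \<^prop>\<open>enat n < N\<close> matter.
\<close>

definition admissible :: "enat \<Rightarrow> (nat \<Rightarrow> real) \<Rightarrow> (nat \<Rightarrow> real) \<Rightarrow> bool" where
  "admissible N s e \<longleftrightarrow>
     (\<forall>n. enat n < N \<longrightarrow> s n > 0 \<and> e n > 0) \<and>
     (N = \<infinity> \<longrightarrow> filterlim s at_top sequentially) \<and>
     (\<lambda>n. e n / s n) summable_on {n. enat n < N}"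

definition power_product :: "enat \<Rightarrow> (nat \<Rightarrow> real) \<Rightarrow> (nat \<Rightarrow> real) \<Rightarrow> complex \<Rightarrow> complex" where
  "power_product N s e w =
     (\<Prod>n. if enat n < N then (1 + w / of_real (s n)) powr of_real (e n) else 1)"

text \<open>
  The formula is only used for \<^prop>\<open>z \<in> upper_halfplane\<close>. There \<^term>\<open>z\<close> and the bases of all
  the other powers are non-real, so the principal powers are holomorphic. Any other
  single-valued branch differs from this one by a constant factor of modulus 1, which
  changes \<^term>\<open>C\<close> only.
\<close>

definition W_formula ::
  "real \<Rightarrow> real \<Rightarrow> real \<Rightarrow> complex \<Rightarrow>
   enat \<Rightarrow> (nat \<Rightarrow> real) \<Rightarrow> (nat \<Rightarrow> real) \<Rightarrow>
   enat \<Rightarrow> (nat \<Rightarrow> real) \<Rightarrow> (nat \<Rightarrow> real) \<Rightarrow>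
   enat \<Rightarrow> (nat \<Rightarrow> real) \<Rightarrow> (nat \<Rightarrow> real) \<Rightarrow>
   enat \<Rightarrow> (nat \<Rightarrow> real) \<Rightarrow> (nat \<Rightarrow> real) \<Rightarrow> complex \<Rightarrow> complex" where
  "W_formula A A0 B C Na a \<kappa> Nb b l Nc c \<kappa>' Nd d l' z =
     exp (of_real A * z + C + of_real A0 / z) * z powr of_real B
     * (power_product Na a \<kappa> z / power_product Nb b l (- z))
     * (power_product Nc c \<kappa>' (1 / z) / power_product Nd d l' (- (1 / z)))"

text \<open>
  \<^term>\<open>takes_value W z w\<close>: the extension of \<^term>\<open>W\<close> from the open half-plane to the real points
  at which it is finite is defined at \<^term>\<open>z\<close> and equals \<^term>\<open>w\<close>. At real points the extension
  is the limit from the half-plane. Principal values at real points would not do: for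
  \<^prop>\<open>x > b\<close> the principal argument of \<^term>\<open>1 - x / b\<close> is \<^term>\<open>pi\<close>, the limit is \<^term>\<open>- pi\<close>;
  moreover \<^prop>\<open>x / 0 = 0\<close> would give a value at the poles.
\<close>

definition takes_value :: "(complex \<Rightarrow> complex) \<Rightarrow> complex \<Rightarrow> complex \<Rightarrow> bool" where
  "takes_value W z w \<longleftrightarrow>
     (Im z > 0 \<and> W z = w) \<or> (Im z = 0 \<and> (W \<longlongrightarrow> w) (at z within upper_halfplane))"

text \<open>
  At a real point the derivatives are those of the analytic continuation \<^term>\<open>g\<close> of \<^term>\<open>W\<close> to
  a full neighbourhood, whose existence is part of the property. The germ of \<^term>\<open>g\<close> at
  \<^term>\<open>z\<close> is unique; for \<^prop>\<open>Im z > 0\<close> it is the germ of \<^term>\<open>W\<close>.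
\<close>

definition point_of_multiplicity ::
  "(complex \<Rightarrow> complex) \<Rightarrow> complex \<Rightarrow> complex \<Rightarrow> nat \<Rightarrow> bool" where
  "point_of_multiplicity W \<alpha> z n \<longleftrightarrow>
     n \<ge> 1 \<and>
     (\<exists>g r. r > 0 \<and> g holomorphic_on ball z r \<and>
        (\<forall>w \<in> ball z r \<inter> upper_halfplane. g w = W w) \<and>
        g z = \<alpha> \<and> (\<forall>k \<in> {1..<n}. (deriv ^^ k) g z = 0) \<and> (deriv ^^ n) g z \<noteq> 0)"

end

theory Submission imports Defs begin

text \<open>
  In the upper half-plane \<open>W = exp G\<close>, where \<open>G\<close> is a sum of logarithms, and \<open>H = z G'\<close> is
  \<open>B\<close> plus terms \<open>A z\<close>, \<open>- A0 / z\<close>, \<open>\<kappa> z / (a + z)\<close>, \<dots> each of which has positive imaginary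
  part. Hence \<open>Im H > 0\<close>, so \<open>W'\<close> has no zero there. On half-circles \<open>z = r exp (\<i> \<theta>)\<close> one has
  \<open>d/d\<theta> ln \<bar>W\<bar> = - Im H < 0\<close>, so \<open>\<bar>W\<bar>\<close> is strictly monotone, and this passes to the limits at the
  end points. A real point other than 0 where \<open>W\<close> has a finite nonzero limit is not one of the
  singular points of the product, for on each half-axis these are either all zeros or all poles; there
  \<open>G\<close> continues analytically, and as \<open>Im H > 0\<close> on one side, \<open>H\<close> vanishes to order at most 1, so
  \<open>W'\<close> does too.
\<close>

section \<open>A logarithm that is analytic across the real axis\<close>

text \<open>
  The logarithm cut along the half-axis \<^term>\<open>- (\<sigma> * \<i>)\<close>, for \<open>\<sigma> = 1\<close> or \<open>\<sigma> = - 1\<close>. It agrees with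
  \<^const>\<open>Ln\<close> where \<^prop>\<open>\<sigma> * Im w > 0\<close> and is analytic at all real points except 0, so that it
  provides the continuation across the real axis.
\<close>

definition slit_Ln :: "real \<Rightarrow> complex \<Rightarrow> complex" where
  "slit_Ln \<sigma> w = Ln (- (of_real \<sigma> * \<i> * w)) + of_real \<sigma> * \<i> * of_real (pi / 2)"

lemma exp_i_sign:
  fixes \<sigma> :: real
  assumes "\<sigma> = 1 \<or> \<sigma> = -1"
  shows "exp (of_real \<sigma> * \<i> * of_real (pi / 2)) = of_real \<sigma> * \<i>"
  using assms
proof
  assume "\<sigma> = 1"
  then show ?thesis by (simp add: complex_eq_iff Re_exp Im_exp)
next
  assume "\<sigma> = -1"
  then show ?thesis by (simp add: complex_eq_iff Re_exp Im_exp)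
qed

text \<open>Both sides are logarithms of \<open>w\<close>, so it suffices that the imaginary part of
  the left one lies in the principal range. For \<open>\<sigma> * Im w > 0\<close> the rotated point
  \<open>u\<close> lies in the right half-plane, so the shift by \<open>\<sigma> * pi / 2\<close> is
  harmless. For \<open>Re w > 0\<close> the argument of \<open>u\<close> has sign opposite to
  \<sigma>, and the shift moves it towards 0.\<close>

lemma slit_Ln_eq_Ln:
  assumes \<sigma>: "\<sigma> = 1 \<or> \<sigma> = -1" and w: "Re w > 0 \<or> \<sigma> * Im w > 0"
  shows "slit_Ln \<sigma> w = Ln w"
proof (rule sym, rule Ln_unique)
  have nz: "w \<noteq> 0" using w by auto
  then have nz': "- (of_real \<sigma> * \<i> * w) \<noteq> 0" using \<sigma> by auto
  have "exp (slit_Ln \<sigma> w) = - (of_real \<sigma> * \<i> * w) * (of_real \<sigma> * \<i>)"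
    unfolding slit_Ln_def exp_add exp_i_sign[OF \<sigma>] using exp_Ln[OF nz'] by simp
  then show "exp (slit_Ln \<sigma> w) = w" using \<sigma> by (auto simp: complex_eq_iff)
  define u where "u = - (of_real \<sigma> * \<i> * w)"
  have u: "Re u = \<sigma> * Im w" "Im u = - \<sigma> * Re w" by (auto simp: u_def)
  have Im: "Im (slit_Ln \<sigma> w) = Im (Ln u) + \<sigma> * pi / 2"
    by (simp add: slit_Ln_def u_def)
  have "u \<noteq> 0" using nz' by (simp add: u_def)
  consider "\<sigma> * Im w > 0" | "Re w > 0" using w by blast
  then have "- pi < Im (slit_Ln \<sigma> w) \<and> Im (slit_Ln \<sigma> w) \<le> pi"
  proof cases
    case 1
    then have "\<bar>Im (Ln u)\<bar> < pi / 2" using Re_Ln_pos_lt[OF \<open>u \<noteq> 0\<close>] u by simp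
    then show ?thesis using Im \<sigma> pi_gt_zero by auto
  next
    case 2
    show ?thesis
      using \<sigma>
    proof
      assume s: "\<sigma> = 1"
      then have "Im u < 0" using u 2 by simp
      then have "Im (Ln u) < 0 \<and> - pi < Im (Ln u)"
        using Im_Ln_less_pi mpi_less_Im_Ln[OF \<open>u \<noteq> 0\<close>] Im_Ln_pos_le[OF \<open>u \<noteq> 0\<close>] Im_Ln_le_pi[OF \<open>u \<noteq> 0\<close>]
        by (meson linorder_not_less not_le)
      then show ?thesis using Im s by auto
    next
      assume s: "\<sigma> = -1"
      then have "Im u > 0" using u 2 by simp
      then have "Im (Ln u) > 0 \<and> Im (Ln u) < pi"
        using Im_Ln_pos_lt[OF \<open>u \<noteq> 0\<close>] by auto
      then show ?thesis using Im s by auto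
    qed
  qed
  then show "- pi < Im (slit_Ln \<sigma> w)" "Im (slit_Ln \<sigma> w) \<le> pi" by auto
qed

lemma has_field_derivative_slit_Ln:
  assumes \<sigma>: "\<sigma> = 1 \<or> \<sigma> = -1" and w: "Re w = 0 \<longrightarrow> \<sigma> * Im w > 0"
  shows "(slit_Ln \<sigma> has_field_derivative 1 / w) (at w)"
proof -
  have "- (of_real \<sigma> * \<i> * w) \<notin> \<real>\<^sub>\<le>\<^sub>0"
    using w \<sigma> by (auto simp: complex_nonpos_Reals_iff)
  moreover have "w \<noteq> 0" using w by auto
  ultimately show ?thesis
    unfolding slit_Ln_def[abs_def] using \<sigma>
    by (auto intro!: derivative_eq_intros simp: field_simps)
qed

section \<open>Locally finite sequences of weights on index sets\<close>

definition weight_sequence :: "nat set \<Rightarrow> (nat \<Rightarrow> real) \<Rightarrow> (nat \<Rightarrow> real) \<Rightarrow> bool" where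
  "weight_sequence I s e \<longleftrightarrow>
     (\<forall>n\<in>I. s n > 0 \<and> e n > 0) \<and> (\<forall>R. finite {n \<in> I. s n \<le> R}) \<and>
     (\<lambda>n. e n / s n) summable_on I"

text \<open>Index sets replace lengths because the conditions then pass to subsets, which is needed
  when finitely many factors are split off. Finiteness of \<open>{n \<in> I. s n \<le> R}\<close>
  treats finite and infinite length alike.\<close>

lemma admissible_imp_weight_sequence:
  assumes "admissible N s e"
  shows "weight_sequence {n. enat n < N} s e"
proof -
  have "finite {n \<in> {n. enat n < N}. s n \<le> R}" for R
  proof (cases N)
    case (enat m)
    then show ?thesis by (auto intro: finite_subset[of _ "{..<m}"])
  next
    case infinity
    then have "eventually (\<lambda>n. s n > R) sequentially"
      using assms unfolding admissible_def filterlim_at_top_dense by blast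
    then obtain k where k: "\<And>n. n \<ge> k \<Longrightarrow> s n > R"
      by (auto simp: eventually_sequentially)
    have "{n \<in> {n. enat n < N}. s n \<le> R} \<subseteq> {..<k}"
      using k by (force simp: not_le[symmetric])
    then show ?thesis by (rule finite_subset) simp
  qed
  then show ?thesis using assms by (auto simp: admissible_def weight_sequence_def)
qed

lemma weight_sequence_subset:
  "weight_sequence I s e \<Longrightarrow> J \<subseteq> I \<Longrightarrow> weight_sequence J s e"
  unfolding weight_sequence_def
  by (auto intro: summable_on_subset_banach finite_subset[of "{n \<in> J. s n \<le> _}" "{n \<in> I. s n \<le> _}"])

lemma weight_sequence_summable:
  assumes "weight_sequence I s e"
  shows "summable (\<lambda>n. if n \<in> I then e n / s n else 0)"
proof (rule summable_on_imp_summable)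
  have "(\<lambda>n. e n / s n) summable_on I" using assms by (simp add: weight_sequence_def)
  then show "(\<lambda>n. if n \<in> I then e n / s n else 0) summable_on UNIV"
    by (rule summable_on_cong_neutral[THEN iffD1, rotated -1]) auto
qed

section \<open>Sums of logarithms and their termwise derivatives\<close>

definition log_product_domain :: "real \<Rightarrow> nat set \<Rightarrow> (nat \<Rightarrow> real) \<Rightarrow> complex set" where
  "log_product_domain \<sigma> I s = {w. \<forall>n\<in>I. Re w = - s n \<longrightarrow> \<sigma> * Im w > 0}"

text \<open>Indices outside \<open>I\<close> contribute 0, which matches the factor 1 in
  \<open>power_product\<close>.\<close>

definition log_product :: "real \<Rightarrow> nat set \<Rightarrow> (nat \<Rightarrow> real) \<Rightarrow> (nat \<Rightarrow> real) \<Rightarrow> complex \<Rightarrow> complex" where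
  "log_product \<sigma> I s e w =
     (\<Sum>n. if n \<in> I then of_real (e n) * slit_Ln \<sigma> (1 + w / of_real (s n)) else 0)"

definition log_product' :: "nat set \<Rightarrow> (nat \<Rightarrow> real) \<Rightarrow> (nat \<Rightarrow> real) \<Rightarrow> complex \<Rightarrow> complex" where
  "log_product' I s e w = (\<Sum>n. if n \<in> I then of_real (e n) / (of_real (s n) + w) else 0)"

text \<open>The domain is the plane without the closed vertical rays that start at the points
  \<open>- s n\<close> and lead away from the half-plane \<open>\<sigma> * Im w > 0\<close>. Only
  finitely many of these rays meet a bounded set.\<close>

lemma open_log_product_domain:
  assumes "weight_sequence I s e"
  shows "open (log_product_domain \<sigma> I s)"
proof (rule openI)
  fix p assume p: "p \<in> log_product_domain \<sigma> I s"
  define F where "F = {n \<in> I. s n \<le> norm p + 1}"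
  have F: "finite F" using assms by (simp add: weight_sequence_def F_def)
  define V where "V n = {w. Re w < - s n} \<union> {w. Re w > - s n} \<union> {w. \<sigma> * Im w > 0}" for n
  have "open (V n)" for n
    unfolding V_def by (intro open_Un open_Collect_less continuous_intros)
  then have "open (ball p 1 \<inter> (\<Inter>n\<in>F. V n))"
    using F by (intro open_Int open_INT) auto
  moreover have "p \<in> ball p 1 \<inter> (\<Inter>n\<in>F. V n)"
    using p by (force simp: log_product_domain_def V_def F_def)
  moreover have "ball p 1 \<inter> (\<Inter>n\<in>F. V n) \<subseteq> log_product_domain \<sigma> I s"
  proof
    fix w assume w: "w \<in> ball p 1 \<inter> (\<Inter>n\<in>F. V n)"
    have "\<sigma> * Im w > 0" if "n \<in> I" "Re w = - s n" for n
    proof -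
      have "norm w < norm p + 1"
        using w norm_triangle_ineq2[of w p] by (auto simp: dist_norm norm_minus_commute)
      then have "s n \<le> norm p + 1" using that abs_Re_le_cmod[of w] by auto
      then have "w \<in> V n" using w that by (auto simp: F_def)
      then show ?thesis using that by (auto simp: V_def)
    qed
    then show "w \<in> log_product_domain \<sigma> I s" by (auto simp: log_product_domain_def)
  qed
  ultimately show "\<exists>e>0. ball p e \<subseteq> log_product_domain \<sigma> I s"
    by (meson open_contains_ball subset_trans)
qed

text \<open>The series is dominated locally by a multiple of \<open>e n / s n\<close>, so it may be
  differentiated term by term. For large \<open>n\<close> the point \<open>1 + y / s n\<close> is
  close to 1, where \<open>slit_Ln\<close> is the principal logarithm for either sign.\<close>

lemma
  assumes \<sigma>: "\<sigma> = 1 \<or> \<sigma> = -1" and ws: "weight_sequence I s e"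
    and w: "w \<in> log_product_domain \<sigma> I s"
  shows log_product_sums:
      "(\<lambda>n. if n \<in> I then of_real (e n) * slit_Ln \<sigma> (1 + w / of_real (s n)) else 0)
         sums log_product \<sigma> I s e w"
    and log_product'_sums:
      "(\<lambda>n. if n \<in> I then of_real (e n) / (of_real (s n) + w) else 0) sums log_product' I s e w"
    and has_field_derivative_log_product:
      "(log_product \<sigma> I s e has_field_derivative log_product' I s e w) (at w)"
proof -
  define D where "D = log_product_domain \<sigma> I s"
  define f where
    "f n w = (if n \<in> I then of_real (e n) * slit_Ln \<sigma> (1 + w / of_real (s n)) else 0)" for n w
  define f' :: "nat \<Rightarrow> complex \<Rightarrow> complex" where
    "f' n w = (if n \<in> I then of_real (e n) / (of_real (s n) + w) else 0)" for n w
  have pos: "s n > 0" "e n > 0" if "n \<in> I" for n using ws that by (auto simp: weight_sequence_def)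
  have oD: "open D" unfolding D_def by (rule open_log_product_domain[OF ws])
  have der: "(f n has_field_derivative f' n x) (at x)" if x: "x \<in> D" for n x
  proof (cases "n \<in> I")
    case True
    have sn: "s n > 0" using pos True by simp
    have im: "Re x = - s n \<longrightarrow> \<sigma> * Im x > 0"
      using x True by (auto simp: D_def log_product_domain_def)
    have "Re (1 + x / of_real (s n)) = 0 \<longrightarrow> \<sigma> * Im (1 + x / of_real (s n)) > 0"
      using im sn by (auto simp: field_simps zero_less_mult_iff)
    from has_field_derivative_slit_Ln[OF \<sigma> this]
    have "((\<lambda>x. slit_Ln \<sigma> (1 + x / of_real (s n))) has_field_derivative
        1 / (1 + x / of_real (s n)) * (1 / of_real (s n))) (at x)"
      by (rule DERIV_chain2) (use sn in \<open>auto intro!: derivative_eq_intros\<close>)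
    moreover have "of_real (s n) + x \<noteq> 0"
      using im by (auto simp: complex_eq_iff)
    then have "1 / (1 + x / of_real (s n)) * (1 / of_real (s n)) = 1 / (of_real (s n) + x)"
      using sn by (simp add: field_simps)
    ultimately have "((\<lambda>x. of_real (e n) * slit_Ln \<sigma> (1 + x / of_real (s n))) has_field_derivative
        of_real (e n) * (1 / (of_real (s n) + x))) (at x)"
      by (simp only: DERIV_cmult)
    then show ?thesis using True by (simp add: f_def[abs_def] f'_def)
  next
    case False
    then show ?thesis by (simp add: f_def[abs_def] f'_def)
  qed
  have bound: "\<exists>d h. 0 < d \<and> summable h \<and>
      (\<forall>\<^sub>F n in sequentially. \<forall>y\<in>ball x d \<inter> D. norm (f n y) \<le> h n)" for x
  proof (intro exI conjI)
    \<comment> \<open>In the unit ball around \<open>x\<close> one has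
      \<open>norm y < norm x + 1\<close>. Once \<open>s n > 2 * (norm x + 1)\<close>, the quotient
      \<open>u = y / s n\<close> has norm below 1/2, where
      \<open>norm (Ln (1 + u)) \<le> 2 * norm u\<close>.\<close>
    let ?h = "\<lambda>n. 2 * (norm x + 1) * (if n \<in> I then e n / s n else 0)"
    show "summable ?h" by (intro summable_mult weight_sequence_summable[OF ws])
    have "finite {n \<in> I. s n \<le> 2 * (norm x + 1)}" using ws by (simp add: weight_sequence_def)
    then have "\<forall>\<^sub>F n in sequentially. n \<notin> {n \<in> I. s n \<le> 2 * (norm x + 1)}"
      by (metis (lifting) eventually_sequentially finite_nat_set_iff_bounded_le not_less_eq_eq)
    then show "\<forall>\<^sub>F n in sequentially. \<forall>y\<in>ball x 1 \<inter> D. norm (f n y) \<le> ?h n"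
    proof (rule eventually_mono, intro ballI)
      fix n y assume n: "n \<notin> {n \<in> I. s n \<le> 2 * (norm x + 1)}" and y: "y \<in> ball x 1 \<inter> D"
      show "norm (f n y) \<le> ?h n"
      proof (cases "n \<in> I")
        case True
        have sn: "s n > 2 * (norm x + 1)" using n True by auto
        have ny: "norm y < norm x + 1"
          using y norm_triangle_ineq2[of y x] by (auto simp: dist_norm norm_minus_commute)
        define u where "u = y / of_real (s n)"
        have u: "norm u < 1/2" "norm u \<le> (norm x + 1) / s n"
          using sn ny pos[OF True] by (auto simp: u_def norm_divide field_simps)
        have "Re (1 + u) > 0" using u abs_Re_le_cmod[of u] by auto
        then have "slit_Ln \<sigma> (1 + u) = Ln (1 + u)" using slit_Ln_eq_Ln[OF \<sigma>] by blast
        moreover have "2 * norm u \<le> 2 * ((norm x + 1) / s n)"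
          by (rule mult_left_mono[OF u(2)]) simp
        ultimately have "norm (slit_Ln \<sigma> (1 + u)) \<le> 2 * ((norm x + 1) / s n)"
          using order_trans[OF norm_Ln_le[OF u(1)]] by metis
        then have "e n * norm (slit_Ln \<sigma> (1 + u)) \<le> e n * (2 * ((norm x + 1) / s n))"
          using pos[OF True] by (intro mult_left_mono) auto
        then show ?thesis using True pos[OF True] by (simp add: f_def u_def norm_mult field_simps)
      qed (simp add: f_def)
    qed
  qed auto
  obtain g g' where g: "\<And>x. x \<in> D \<Longrightarrow> (\<lambda>n. f n x) sums g x"
    "\<And>x. x \<in> D \<Longrightarrow> (\<lambda>n. f' n x) sums g' x" "\<And>x. x \<in> D \<Longrightarrow> (g has_field_derivative g' x) (at x)"
    using series_and_derivative_comparison_local[OF oD der bound] by blast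
  have lp: "log_product \<sigma> I s e x = g x" if "x \<in> D" for x
    using g(1)[OF that] by (simp add: log_product_def f_def sums_iff)
  have lp': "log_product' I s e x = g' x" if "x \<in> D" for x
    using g(2)[OF that] by (simp add: log_product'_def f'_def sums_iff)
  have wD: "w \<in> D" using w by (simp add: D_def)
  show "(\<lambda>n. if n \<in> I then of_real (e n) * slit_Ln \<sigma> (1 + w / of_real (s n)) else 0)
         sums log_product \<sigma> I s e w"
    using g(1)[OF wD] lp[OF wD] by (simp add: f_def)
  show "(\<lambda>n. if n \<in> I then of_real (e n) / (of_real (s n) + w) else 0) sums log_product' I s e w"
    using g(2)[OF wD] lp'[OF wD] by (simp add: f'_def)
  show "(log_product \<sigma> I s e has_field_derivative log_product' I s e w) (at w)"
    unfolding lp'[OF wD] using g(3)[OF wD]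
    by (rule has_field_derivative_transform_within_open[OF _ oD wD]) (simp add: lp)
qed

lemma log_product_domain_half_plane: "\<sigma> * Im w > 0 \<Longrightarrow> w \<in> log_product_domain \<sigma> I s"
  by (simp add: log_product_domain_def)

section \<open>Infinite products as exponentials, and the sign of an imaginary part\<close>

lemma prodinf_exp:
  fixes f :: "nat \<Rightarrow> complex"
  assumes "f sums S"
  shows "(\<Prod>n. exp (f n)) = exp S"
proof -
  have "(\<lambda>n. \<Sum>i\<le>n. f i) \<longlonglongrightarrow> S" using assms by (simp add: sums_def_le)
  then have "(\<lambda>n. exp (\<Sum>i\<le>n. f i)) \<longlonglongrightarrow> exp S" by (rule tendsto_exp)
  \<comment> \<open>\<open>has_prod\<close> demands a nonzero limit of the partial products, and
    \<open>exp S\<close> is one.\<close>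
  then have "(\<lambda>n. exp (f n)) has_prod exp S"
    by (auto simp: has_prod_def raw_has_prod_def exp_sum)
  then show ?thesis using has_prod_unique by metis
qed

lemma power_product_eq_exp:
  assumes \<sigma>: "\<sigma> = 1 \<or> \<sigma> = -1" and ws: "weight_sequence {n. enat n < N} s e"
    and w: "\<sigma> * Im w > 0"
  shows "power_product N s e w = exp (log_product \<sigma> {n. enat n < N} s e w)"
proof -
  let ?I = "{n. enat n < N}"
  have "(if enat n < N then (1 + w / of_real (s n)) powr of_real (e n) else 1) =
      exp (if n \<in> ?I then of_real (e n) * slit_Ln \<sigma> (1 + w / of_real (s n)) else 0)" for n
  proof (cases "enat n < N")
    case True
    then have sn: "s n > 0" using ws by (simp add: weight_sequence_def)
    have "\<sigma> * Im (1 + w / of_real (s n)) > 0" using w sn by (simp add: field_simps)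
    moreover from this have "1 + w / of_real (s n) \<noteq> 0" by (metis less_irrefl mult_zero_right zero_complex.sel(2))
    ultimately show ?thesis using True slit_Ln_eq_Ln[OF \<sigma>] by (simp add: powr_def)
  qed auto
  then show ?thesis
    unfolding power_product_def
    using prodinf_exp[OF log_product_sums[OF \<sigma> ws log_product_domain_half_plane[OF w]]] by simp
qed

text \<open>Each term satisfies \<open>\<sigma> * Im (w * e / (s + w)) = e * s * (\<sigma> * Im w) /
  (cmod (s + w))^2\<close>, which is positive. A single index therefore makes the sum
  positive.\<close>

lemma Im_mult_log_product':
  assumes \<sigma>: "\<sigma> = 1 \<or> \<sigma> = -1" and ws: "weight_sequence I s e" and w: "\<sigma> * Im w > 0"
  shows "\<sigma> * Im (w * log_product' I s e w) \<ge> 0"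
    and "I \<noteq> {} \<Longrightarrow> \<sigma> * Im (w * log_product' I s e w) > 0"
proof -
  define t where "t n = (if n \<in> I then e n * s n * (\<sigma> * Im w) / (cmod (of_real (s n) + w))\<^sup>2 else 0)" for n
  have "(\<lambda>n. \<sigma> * Im (w * (if n \<in> I then of_real (e n) / (of_real (s n) + w) else 0)))
      sums (\<sigma> * Im (w * log_product' I s e w))"
    by (intro sums_mult sums_Im log_product'_sums[OF \<sigma> ws] log_product_domain_half_plane w)
  moreover have "\<sigma> * Im (w * (if n \<in> I then of_real (e n) / (of_real (s n) + w) else 0)) = t n" for n
    by (simp add: t_def Im_divide cmod_power2 Re_divide divide_simps) (auto simp: algebra_simps)
  ultimately have sums: "t sums (\<sigma> * Im (w * log_product' I s e w))" by simp
  have tpos: "t n > 0" if "n \<in> I" for n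
  proof -
    have "of_real (s n) + w \<noteq> 0" using w by (auto simp: complex_eq_iff)
    then show ?thesis using that ws w by (auto simp: t_def weight_sequence_def)
  qed
  then have nonneg: "t n \<ge> 0" for n by (cases "n \<in> I") (auto simp: t_def less_imp_le)
  show "\<sigma> * Im (w * log_product' I s e w) \<ge> 0"
    using sums nonneg by (metis sums_iff suminf_nonneg)
  assume "I \<noteq> {}"
  then obtain n where "n \<in> I" by auto
  then have "suminf t > 0" using sums nonneg tpos by (intro suminf_pos2) (auto simp: sums_iff)
  then show "\<sigma> * Im (w * log_product' I s e w) > 0" using sums by (simp add: sums_iff)
qed

section \<open>Limits of the products at real points\<close>

lemma log_product_remove_finite:
  assumes \<sigma>: "\<sigma> = 1 \<or> \<sigma> = -1" and ws: "weight_sequence I s e" and w: "\<sigma> * Im w > 0"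
    and F: "finite F" "F \<subseteq> I"
  shows "log_product \<sigma> I s e w =
    log_product \<sigma> (I - F) s e w + (\<Sum>n\<in>F. of_real (e n) * slit_Ln \<sigma> (1 + w / of_real (s n)))"
proof (rule sums_unique2)
  define t where "t n = of_real (e n) * slit_Ln \<sigma> (1 + w / of_real (s n))" for n
  have d: "w \<in> log_product_domain \<sigma> J s" for J using w by (rule log_product_domain_half_plane)
  show "(\<lambda>n. if n \<in> I then of_real (e n) * slit_Ln \<sigma> (1 + w / of_real (s n)) else 0)
      sums log_product \<sigma> I s e w"
    by (rule log_product_sums[OF \<sigma> ws d])
  have "(\<lambda>n. (if n \<in> I - F then t n else 0) + (if n \<in> F then t n else 0))
      sums (log_product \<sigma> (I - F) s e w + sum t F)"
    using log_product_sums[OF \<sigma> weight_sequence_subset[OF ws] d, of "I - F"] F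
    by (intro sums_add sums_If_finite_set) (auto simp: t_def cong: if_cong)
  moreover have "(\<lambda>n. (if n \<in> I - F then t n else 0) + (if n \<in> F then t n else 0)) =
      (\<lambda>n. if n \<in> I then t n else 0)"
    using F by (auto simp: fun_eq_iff)
  ultimately show "(\<lambda>n. if n \<in> I then of_real (e n) * slit_Ln \<sigma> (1 + w / of_real (s n)) else 0)
      sums (log_product \<sigma> (I - F) s e w + (\<Sum>n\<in>F. of_real (e n) * slit_Ln \<sigma> (1 + w / of_real (s n))))"
    by (simp add: t_def cong: if_cong)
qed

text \<open>Finitely many factors vanish at \<open>p\<close>, and at least one does; each of them
  tends to 0 because its exponent is positive. The product of the remaining factors is continuous at
  \<open>p\<close>.\<close>

lemma exp_log_product_tendsto_0:
  assumes \<sigma>: "\<sigma> = 1 \<or> \<sigma> = -1" and ws: "weight_sequence I s e"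
    and p: "Im p = 0" "p \<notin> log_product_domain \<sigma> I s"
  shows "((\<lambda>w. exp (log_product \<sigma> I s e w)) \<longlongrightarrow> 0) (at p within {w. \<sigma> * Im w > 0})"
proof -
  \<comment> \<open>These are the indices of the factors that vanish at \<open>p\<close>; since
    \<open>Im p = 0\<close>, they are exactly those that keep \<open>p\<close> out of the
    domain.\<close>
  define F where "F = {n \<in> I. s n = - Re p}"
  have F: "finite F" "F \<subseteq> I" "F \<noteq> {}"
    using ws p
    by (auto simp: weight_sequence_def F_def log_product_domain_def
        intro: finite_subset[of _ "{n \<in> I. s n \<le> - Re p}"])
  have ws': "weight_sequence (I - F) s e" using ws by (rule weight_sequence_subset) auto
  have "p \<in> log_product_domain \<sigma> (I - F) s" by (auto simp: log_product_domain_def F_def)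
  then have "isCont (log_product \<sigma> (I - F) s e) p"
    using has_field_derivative_log_product[OF \<sigma> ws'] DERIV_isCont by blast
  then have 1: "((\<lambda>w. exp (log_product \<sigma> (I - F) s e w)) \<longlongrightarrow> exp (log_product \<sigma> (I - F) s e p))
      (at p within {w. \<sigma> * Im w > 0})"
    by (intro tendsto_exp) (auto simp: isCont_def intro: tendsto_within_subset)
  have 2: "((\<lambda>w. (1 + w / of_real (s n)) powr of_real (e n)) \<longlongrightarrow> 0)
      (at p within {w. \<sigma> * Im w > 0})" if "n \<in> F" for n
  proof (rule tendsto_powr_complex_0)
    have sn: "s n > 0" "e n > 0" using that ws F by (auto simp: weight_sequence_def)
    have "1 + p / of_real (s n) = 0"
      using that p sn by (auto simp: F_def complex_eq_iff)
    moreover have "((\<lambda>w. 1 + w / of_real (s n)) \<longlongrightarrow> 1 + p / of_real (s n))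
      (at p within {w. \<sigma> * Im w > 0})"
      using sn by (intro tendsto_intros) auto
    ultimately show "((\<lambda>w. 1 + w / of_real (s n)) \<longlongrightarrow> 0) (at p within {w. \<sigma> * Im w > 0})" by simp
    show "((\<lambda>_. complex_of_real (e n)) \<longlongrightarrow> of_real (e n)) (at p within {w. \<sigma> * Im w > 0})"
      by (rule tendsto_const)
    show "0 < Re (complex_of_real (e n))" using sn by simp
  qed
  have "((\<lambda>w. exp (log_product \<sigma> (I - F) s e w) *
        (\<Prod>n\<in>F. (1 + w / of_real (s n)) powr of_real (e n))) \<longlongrightarrow>
      exp (log_product \<sigma> (I - F) s e p) * (\<Prod>n\<in>F. 0)) (at p within {w. \<sigma> * Im w > 0})"
    by (intro tendsto_mult 1 tendsto_prod 2)
  then have "((\<lambda>w. exp (log_product \<sigma> (I - F) s e w) *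
        (\<Prod>n\<in>F. (1 + w / of_real (s n)) powr of_real (e n))) \<longlongrightarrow> 0) (at p within {w. \<sigma> * Im w > 0})"
    using F by (simp add: prod_constant card_gt_0_iff zero_power)
  moreover have "exp (log_product \<sigma> I s e w) = exp (log_product \<sigma> (I - F) s e w) *
        (\<Prod>n\<in>F. (1 + w / of_real (s n)) powr of_real (e n))" if w: "\<sigma> * Im w > 0" for w
  proof -
    have "exp (of_real (e n) * slit_Ln \<sigma> (1 + w / of_real (s n))) =
        (1 + w / of_real (s n)) powr of_real (e n)" if "n \<in> F" for n
    proof -
      have sn: "s n > 0" using that ws F by (auto simp: weight_sequence_def)
      have "\<sigma> * Im (1 + w / of_real (s n)) > 0" using w sn by (simp add: field_simps)
      moreover from this have "1 + w / of_real (s n) \<noteq> 0"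
        by (metis less_irrefl mult_zero_right zero_complex.sel(2))
      ultimately show ?thesis using slit_Ln_eq_Ln[OF \<sigma>] by (simp add: powr_def)
    qed
    then show ?thesis
      using F unfolding log_product_remove_finite[OF \<sigma> ws w F(1,2)] exp_add
      by (simp add: exp_sum)
  qed
  ultimately show ?thesis
    by (smt (verit) Lim_cong_within mem_Collect_eq)
qed

text \<open>The limit always exists, and its vanishing detects the singular points; this allows all
  four products to be compared with the limit of \<open>W\<close>.\<close>

lemma exp_log_product_limit:
  assumes \<sigma>: "\<sigma> = 1 \<or> \<sigma> = -1" and ws: "weight_sequence I s e" and p: "Im p = 0"
  obtains L where "((\<lambda>w. exp (log_product \<sigma> I s e w)) \<longlongrightarrow> L) (at p within {w. \<sigma> * Im w > 0})"
    "L \<noteq> 0 \<longleftrightarrow> p \<in> log_product_domain \<sigma> I s"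
proof (cases "p \<in> log_product_domain \<sigma> I s")
  case True
  then have "isCont (log_product \<sigma> I s e) p"
    using has_field_derivative_log_product[OF \<sigma> ws] DERIV_isCont by blast
  then have "((\<lambda>w. exp (log_product \<sigma> I s e w)) \<longlongrightarrow> exp (log_product \<sigma> I s e p))
      (at p within {w. \<sigma> * Im w > 0})"
    by (intro tendsto_exp) (auto simp: isCont_def intro: tendsto_within_subset)
  then show ?thesis using that True by force
next
  case False
  then show ?thesis using that exp_log_product_tendsto_0[OF \<sigma> ws p] by blast
qed

section \<open>The logarithm of \<open>W\<close> and its logarithmic derivative\<close>

locale power_product_data =
  fixes A A0 B :: real and C :: complex
    and Ia Ib Ic Id :: "nat set" and a b c d \<kappa> l \<kappa>' l' :: "nat \<Rightarrow> real"
  assumes A: "A \<ge> 0" "A0 \<ge> 0"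
    and ws: "weight_sequence Ia a \<kappa>" "weight_sequence Ib b l"
      "weight_sequence Ic c \<kappa>'" "weight_sequence Id d l'"
    and nontrivial: "A \<noteq> 0 \<or> A0 \<noteq> 0 \<or> Ia \<noteq> {} \<or> Ib \<noteq> {} \<or> Ic \<noteq> {} \<or> Id \<noteq> {}"
begin

text \<open>This is \<open>G\<close> of the overview. For \<open>Im z > 0\<close> the sign given to
  each logarithm is that of the imaginary part of its argument, so it is the principal logarithm
  there.\<close>

definition log_W :: "complex \<Rightarrow> complex" where
  "log_W z = (of_real A * z + C + of_real A0 / z) + of_real B * slit_Ln 1 z
     + (log_product 1 Ia a \<kappa> z - log_product (- 1) Ib b l (- z))
     + (log_product (- 1) Ic c \<kappa>' (1 / z) - log_product 1 Id d l' (- (1 / z)))"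

text \<open>The first set excludes 0. The domain contains the open upper half-plane and every other
  real point at which no factor of the products vanishes.\<close>

definition W_domain :: "complex set" where
  "W_domain = {z. Re z = 0 \<longrightarrow> Im z > 0} \<inter> log_product_domain 1 Ia a
     \<inter> {z. - z \<in> log_product_domain (- 1) Ib b}
     \<inter> {z. 1 / z \<in> log_product_domain (- 1) Ic c}
     \<inter> {z. - (1 / z) \<in> log_product_domain 1 Id d}"

text \<open>This is \<open>H\<close> of the overview. Each \<open>log_product'\<close> is multiplied
  by its own argument, the form in which \<open>Im_mult_log_product'\<close> applies.\<close>

definition zdlog_W :: "complex \<Rightarrow> complex" where
  "zdlog_W z = of_real A * z + of_real B - of_real A0 / z
     + z * log_product' Ia a \<kappa> z - (- z) * log_product' Ib b l (- z)
     - (1 / z) * log_product' Ic c \<kappa>' (1 / z) + (- (1 / z)) * log_product' Id d l' (- (1 / z))"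

lemma open_W_domain: "open W_domain"
proof -
  \<comment> \<open>Preimages are taken within the open set \<open>E\<close>, which omits 0 and so
    makes inversion continuous.\<close>
  define E where "E = {z::complex. Re z = 0 \<longrightarrow> Im z > 0}"
  have "E = {z. Re z < 0} \<union> {z. Re z > 0} \<union> {z. Im z > 0}" by (auto simp: E_def)
  then have oE: "open E" by (simp add: open_Un open_halfspace_Re_lt open_halfspace_Re_gt open_halfspace_Im_gt)
  have pre: "open (E \<inter> f -` V)" if "open V" "continuous_on E f" for V and f :: "complex \<Rightarrow> complex"
    using that oE by (intro continuous_open_preimage) auto
  have "W_domain = (E \<inter> log_product_domain 1 Ia a) \<inter> (E \<inter> uminus -` log_product_domain (- 1) Ib b)
     \<inter> (E \<inter> (\<lambda>z. 1 / z) -` log_product_domain (- 1) Ic c)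
     \<inter> (E \<inter> (\<lambda>z. - (1 / z)) -` log_product_domain 1 Id d)"
    by (auto simp: W_domain_def E_def)
  then show ?thesis
    by (simp only:) (intro open_Int oE pre open_log_product_domain[OF ws(1)]
      open_log_product_domain[OF ws(2)] open_log_product_domain[OF ws(3)]
      open_log_product_domain[OF ws(4)] continuous_intros; auto simp: E_def)
qed

text \<open>The explicit factors \<open>1\<close> and \<open>- 1\<close> are the values of \<sigma>
  used for the four products.\<close>

lemma upper_half_plane_moebius:
  assumes "Im z > 0"
  shows "- 1 * Im (- z) > 0" "- 1 * Im (1 / z) > 0" "1 * Im (- (1 / z)) > 0" "1 * Im z > 0"
  using assms by (auto simp: Im_divide zero_less_divide_iff sum_power2_gt_zero_iff divide_less_0_iff)

lemma half_plane_subset_W_domain: "Im z > 0 \<Longrightarrow> z \<in> W_domain"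
  using upper_half_plane_moebius[of z]
  by (auto simp: W_domain_def intro!: log_product_domain_half_plane)

lemma has_field_derivative_log_W:
  assumes z: "z \<in> W_domain"
  shows "(log_W has_field_derivative zdlog_W z / z) (at z)"
proof -
  have nz: "z \<noteq> 0" using z by (auto simp: W_domain_def)
  have "((\<lambda>z. log_product 1 Ia a \<kappa> z) has_field_derivative log_product' Ia a \<kappa> z) (at z)"
    using z by (intro has_field_derivative_log_product ws) (auto simp: W_domain_def)
  moreover have "((\<lambda>z. log_product (- 1) Ib b l (- z)) has_field_derivative
      log_product' Ib b l (- z) * (- 1)) (at z)"
    by (rule DERIV_chain2[OF has_field_derivative_log_product[OF _ ws(2)]])
       (use z in \<open>auto simp: W_domain_def intro!: derivative_eq_intros\<close>)
  moreover have "((\<lambda>z. log_product (- 1) Ic c \<kappa>' (1 / z)) has_field_derivative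
      log_product' Ic c \<kappa>' (1 / z) * (- (1 / z\<^sup>2))) (at z)"
    by (rule DERIV_chain2[OF has_field_derivative_log_product[OF _ ws(3)]])
       (use z nz in \<open>auto simp: W_domain_def power2_eq_square intro!: derivative_eq_intros\<close>)
  moreover have "((\<lambda>z. log_product 1 Id d l' (- (1 / z))) has_field_derivative
      log_product' Id d l' (- (1 / z)) * (1 / z\<^sup>2)) (at z)"
    by (rule DERIV_chain2[OF has_field_derivative_log_product[OF _ ws(4)]])
       (use z nz in \<open>auto simp: W_domain_def power2_eq_square intro!: derivative_eq_intros\<close>)
  moreover have "((\<lambda>z. of_real A * z + C + of_real A0 / z) has_field_derivative
      of_real A - of_real A0 / z\<^sup>2) (at z)"
    using nz by (auto intro!: derivative_eq_intros simp: power2_eq_square)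
  moreover have "((\<lambda>z. of_real B * slit_Ln 1 z) has_field_derivative of_real B * (1 / z)) (at z)"
    using z by (intro DERIV_cmult has_field_derivative_slit_Ln) (auto simp: W_domain_def)
  ultimately have "(log_W has_field_derivative
      (of_real A - of_real A0 / z\<^sup>2) + of_real B * (1 / z)
      + (log_product' Ia a \<kappa> z - log_product' Ib b l (- z) * (- 1))
      + (log_product' Ic c \<kappa>' (1 / z) * (- (1 / z\<^sup>2)) - log_product' Id d l' (- (1 / z)) * (1 / z\<^sup>2))) (at z)"
    unfolding log_W_def[abs_def] by (intro DERIV_add DERIV_diff) auto
  moreover have "(of_real A - of_real A0 / z\<^sup>2) + of_real B * (1 / z)
      + (log_product' Ia a \<kappa> z - log_product' Ib b l (- z) * (- 1))
      + (log_product' Ic c \<kappa>' (1 / z) * (- (1 / z\<^sup>2)) - log_product' Id d l' (- (1 / z)) * (1 / z\<^sup>2))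
      = zdlog_W z / z"
    using nz by (simp add: zdlog_W_def divide_simps power2_eq_square) (simp add: algebra_simps)
  ultimately show ?thesis by simp
qed

lemma holomorphic_log_W: "log_W holomorphic_on W_domain"
  using has_field_derivative_log_W open_W_domain holomorphic_on_open by blast

text \<open>Writing it as \<open>z * deriv log_W z\<close> avoids differentiating the series
  \<open>log_product'\<close>.\<close>

lemma holomorphic_zdlog_W: "zdlog_W holomorphic_on W_domain"
proof (rule holomorphic_transform)
  show "(\<lambda>z. z * deriv log_W z) holomorphic_on W_domain"
    by (intro holomorphic_intros holomorphic_log_W open_W_domain)
  show "z * deriv log_W z = zdlog_W z" if "z \<in> W_domain" for z
    using that DERIV_imp_deriv[OF has_field_derivative_log_W[OF that]] by (auto simp: W_domain_def)
qed

text \<open>The real constant \<open>B\<close> drops out, the six other contributions are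
  nonnegative, and \<open>nontrivial\<close> makes one of them positive.\<close>

lemma Im_zdlog_W_pos:
  assumes z: "Im z > 0"
  shows "Im (zdlog_W z) > 0"
proof -
  note m = upper_half_plane_moebius[OF z]
  have zz: "cmod z > 0" using z by auto
  define ta where "ta = Im (z * log_product' Ia a \<kappa> z)"
  define tb where "tb = - Im ((- z) * log_product' Ib b l (- z))"
  define tc where "tc = - Im ((1 / z) * log_product' Ic c \<kappa>' (1 / z))"
  define td where "td = Im ((- (1 / z)) * log_product' Id d l' (- (1 / z)))"
  have ta: "ta \<ge> 0" "Ia \<noteq> {} \<Longrightarrow> ta > 0"
    using Im_mult_log_product'[OF _ ws(1) m(4)] by (auto simp: ta_def)
  have tb: "tb \<ge> 0" "Ib \<noteq> {} \<Longrightarrow> tb > 0"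
    using Im_mult_log_product'[OF _ ws(2) m(1)] by (auto simp: tb_def)
  have tc: "tc \<ge> 0" "Ic \<noteq> {} \<Longrightarrow> tc > 0"
    using Im_mult_log_product'[OF _ ws(3) m(2)] by (auto simp: tc_def)
  have td: "td \<ge> 0" "Id \<noteq> {} \<Longrightarrow> td > 0"
    using Im_mult_log_product'[OF _ ws(4) m(3)] by (auto simp: td_def)
  have 1: "A * Im z \<ge> 0" "A \<noteq> 0 \<Longrightarrow> A * Im z > 0" using A z by auto
  have 2: "A0 * Im z / (cmod z)\<^sup>2 \<ge> 0" "A0 \<noteq> 0 \<Longrightarrow> A0 * Im z / (cmod z)\<^sup>2 > 0"
    using A z zz by auto
  have "Im (of_real A0 / z) = - (A0 * Im z / (cmod z)\<^sup>2)"
    by (simp add: Im_divide cmod_power2)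
  then have "Im (zdlog_W z) = A * Im z + A0 * Im z / (cmod z)\<^sup>2 + ta + tb + tc + td"
    by (simp add: zdlog_W_def ta_def tb_def tc_def td_def)
  then show ?thesis using ta tb tc td 1 2 nontrivial
    by (smt (verit))
qed

section \<open>Monotonicity of the modulus along half-circles\<close>

lemma Re_log_W_circle_decreasing:
  assumes r: "r > 0" and \<theta>: "0 < \<theta>1" "\<theta>1 < \<theta>2" "\<theta>2 < pi"
  shows "Re (log_W (rcis r \<theta>2)) < Re (log_W (rcis r \<theta>1))"
proof (rule DERIV_neg_imp_decreasing[OF \<theta>(2)])
  fix x assume x: "\<theta>1 \<le> x" "x \<le> \<theta>2"
  define z where "z = rcis r x"
  have Im: "Im z > 0" using x \<theta> r by (auto simp: z_def intro!: mult_pos_pos sin_gt_zero)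
  have nz: "z \<noteq> 0" using Im by auto
  have "(rcis r has_vector_derivative \<i> * z) (at x)"
    unfolding has_vector_derivative_complex_iff z_def
    by (auto intro!: derivative_eq_intros)
  from field_vector_diff_chain_at[OF this]
  have "((log_W \<circ> rcis r) has_vector_derivative (\<i> * z) * (zdlog_W z / z)) (at x)"
    using has_field_derivative_log_W[OF half_plane_subset_W_domain[OF Im]] unfolding z_def by blast
  \<comment> \<open>The velocity \<open>\<i> * z\<close> of the circle cancels the denominator; the
    real part of what remains is \<open>- Im (zdlog_W z)\<close>.\<close>
  moreover have "(\<i> * z) * (zdlog_W z / z) = \<i> * zdlog_W z" using nz by simp
  ultimately have "((\<lambda>x. Re ((log_W \<circ> rcis r) x)) has_field_derivative Re (\<i> * zdlog_W z)) (at x)"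
    using nz by (intro has_field_derivative_Re) (simp add: o_def)
  then show "\<exists>y. ((\<lambda>x. Re (log_W (rcis r x))) has_field_derivative y) (at x) \<and> y < 0"
    using Im_zdlog_W_pos[OF Im] by (intro exI[of _ "Re (\<i> * zdlog_W z)"]) simp
qed

text \<open>The filter \<open>F\<close> is left open so as to serve both ends of the arc,
  \<open>at_right 0\<close> and \<open>at_left pi\<close>. The condition on
  \<open>sin \<phi>\<close> makes the end point real, hence different from the points of the
  arc.\<close>

lemma tendsto_limit_along_circle:
  assumes W: "(W \<longlongrightarrow> v) (at (rcis r \<phi>) within upper_halfplane)" and r: "r > 0"
    and F: "F \<le> at \<phi>" "\<forall>\<^sub>F \<theta> in F. 0 < \<theta> \<and> \<theta> < pi" and \<phi>: "sin \<phi> = 0"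
  shows "((\<lambda>\<theta>. norm (W (rcis r \<theta>))) \<longlongrightarrow> norm v) F"
proof (rule tendsto_norm[OF filterlim_compose[OF W]])
  have "(rcis r \<longlongrightarrow> rcis r \<phi>) (at \<phi>)"
    using continuous_on_rcis[of UNIV "\<lambda>_. r" "\<lambda>x. x"]
    by (simp add: continuous_on_eq_continuous_at isCont_def)
  then have lim: "(rcis r \<longlongrightarrow> rcis r \<phi>) F" using F(1) by (rule tendsto_mono[rotated])
  have "\<forall>\<^sub>F \<theta> in F. rcis r \<theta> \<in> upper_halfplane \<and> rcis r \<theta> \<noteq> rcis r \<phi>"
    using F(2)
  proof (rule eventually_mono)
    fix \<theta> assume "0 < \<theta> \<and> \<theta> < pi"
    then have "Im (rcis r \<theta>) > 0" using r by (auto intro!: mult_pos_pos sin_gt_zero)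
    moreover have "Im (rcis r \<phi>) = 0" using \<phi> by simp
    ultimately show "rcis r \<theta> \<in> upper_halfplane \<and> rcis r \<theta> \<noteq> rcis r \<phi>"
      by (auto simp: upper_halfplane_def simp del: Im_rcis)
  qed
  then show "filterlim (rcis r) (at (rcis r \<phi>) within upper_halfplane) F"
    using lim by (auto simp: filterlim_at elim: eventually_mono)
qed

text \<open>Both points lie on one half-circle, where the modulus decreases strictly with the angle.
  At an end point the limit yields only a weak inequality, so an angle strictly between \<theta> and
  the end, \<open>\<theta> / 2\<close> or \<open>(\<theta> + pi) / 2\<close>, keeps the comparison
  strict.\<close>

lemma norm_distinct_on_circle:
  assumes W: "\<And>z. Im z > 0 \<Longrightarrow> W z = exp (log_W z)"
    and z: "Im z > 0" and w: "Im w \<ge> 0" "takes_value W w v" "w \<noteq> z" "norm w = norm z"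
  shows "norm v \<noteq> norm (W z)"
proof -
  define r where "r = norm z"
  define f where "f \<theta> = norm (W (rcis r \<theta>))" for \<theta>
  define \<theta> where "\<theta> = Arg z"
  define \<phi> where "\<phi> = Arg w"
  have r: "r > 0" using z by (auto simp: r_def)
  have zr: "z = rcis r \<theta>" by (simp add: r_def \<theta>_def rcis_cmod_Arg)
  have wr: "w = rcis r \<phi>" using w(4) by (metis \<phi>_def r_def rcis_cmod_Arg)
  have \<theta>: "0 < \<theta>" "\<theta> < pi" using z Arg_lt_pi[of z] by (auto simp: \<theta>_def)
  have \<phi>: "0 \<le> \<phi>" "\<phi> \<le> pi" using w(1) Arg_less_0[of w] Arg_le_pi[of w] by (auto simp: \<phi>_def)
  have Im: "Im (rcis r x) > 0" if "0 < x" "x < pi" for x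
    using that r by (auto intro!: mult_pos_pos sin_gt_zero)
  have dec: "f y < f x" if "0 < x" "x < y" "y < pi" for x y
    using Re_log_W_circle_decreasing[OF r that] Im[of x] Im[of y] that W by (simp add: f_def)
  have "norm v \<noteq> f \<theta>"
  proof -
    consider "0 < \<phi>" "\<phi> < pi" | "\<phi> = 0" | "\<phi> = pi" using \<phi> by linarith
    then show ?thesis
    proof cases
      case 1
      then have "v = W w" using w(2) Im[OF 1] by (auto simp: takes_value_def wr)
      moreover have "\<theta> \<noteq> \<phi>" using w(3) zr wr by auto
      ultimately show ?thesis
        using dec[of \<theta> \<phi>] dec[of \<phi> \<theta>] 1 \<theta> by (cases \<theta> \<phi> rule: linorder_cases) (auto simp: f_def wr)
    next
      case 2
      have ev: "\<forall>\<^sub>F x in at_right 0. 0 < x \<and> x < \<theta> / 2"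
        using eventually_at_right_real[of 0 "\<theta> / 2"] \<theta> by simp
      have "(W \<longlongrightarrow> v) (at (rcis r 0) within upper_halfplane)"
        using w(2) 2 by (auto simp: takes_value_def wr)
      then have "(f \<longlongrightarrow> norm v) (at_right 0)"
        unfolding f_def
        by (rule tendsto_limit_along_circle[OF _ r at_le])
           (use \<theta> in \<open>auto intro: eventually_mono[OF ev]\<close>)
      moreover have "\<forall>\<^sub>F x in at_right 0. f (\<theta> / 2) \<le> f x"
        by (rule eventually_mono[OF ev]) (use \<theta> dec in \<open>auto intro!: less_imp_le\<close>)
      ultimately have "f (\<theta> / 2) \<le> norm v" by (rule tendsto_lowerbound) simp
      then show ?thesis using dec[of "\<theta> / 2" \<theta>] \<theta> by auto
    next
      case 3
      have ev: "\<forall>\<^sub>F x in at_left pi. (\<theta> + pi) / 2 < x \<and> x < pi"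
        using eventually_at_left_real[of "(\<theta> + pi) / 2" pi] \<theta> by simp
      have "(W \<longlongrightarrow> v) (at (rcis r pi) within upper_halfplane)"
        using w(2) 3 by (auto simp: takes_value_def wr)
      then have "(f \<longlongrightarrow> norm v) (at_left pi)"
        unfolding f_def
        by (rule tendsto_limit_along_circle[OF _ r at_le])
           (use \<theta> in \<open>auto intro: eventually_mono[OF ev]\<close>)
      moreover have "\<forall>\<^sub>F x in at_left pi. f x \<le> f ((\<theta> + pi) / 2)"
        by (rule eventually_mono[OF ev]) (use \<theta> dec in \<open>auto intro!: less_imp_le\<close>)
      ultimately have "norm v \<le> f ((\<theta> + pi) / 2)" by (rule tendsto_upperbound) simp
      then show ?thesis using dec[of \<theta> "(\<theta> + pi) / 2"] \<theta> by auto
    qed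
  qed
  then show ?thesis by (simp add: f_def zr)
qed

section \<open>Real points with a finite nonzero limit\<close>

lemma real_point_upper_halfplane_nontrivial:
  assumes "Im x = 0"
  shows "at x within upper_halfplane \<noteq> bot"
proof -
  have "x islimpt upper_halfplane"
    unfolding islimpt_approachable
  proof (intro allI impI)
    fix e :: real assume "e > 0"
    then show "\<exists>x'\<in>upper_halfplane. x' \<noteq> x \<and> dist x' x < e"
      using assms by (intro bexI[of _ "x + \<i> * of_real (e / 2)"])
        (auto simp: dist_norm norm_mult upper_halfplane_def)
  qed
  then show ?thesis by (simp add: trivial_limit_within)
qed

text \<open>Zeros of the numerators lie on the negative half-axis and zeros of the denominators on
  the positive one. They cannot cancel, so each would force the limit of \<open>W\<close> to be zero
  or infinite.\<close>

lemma real_point_in_W_domain: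
  assumes W: "\<And>z. Im z > 0 \<Longrightarrow> W z = exp (log_W z)"
    and x: "x \<noteq> 0" "Im x = 0" and lim: "(W \<longlongrightarrow> \<alpha>) (at x within upper_halfplane)" and "\<alpha> \<noteq> 0"
  shows "x \<in> W_domain"
proof -
  define F where "F = at x within upper_halfplane"
  have F: "F \<noteq> bot"
    unfolding F_def using x(2) by (rule real_point_upper_halfplane_nontrivial)
  have up: "\<forall>\<^sub>F z in F. Im z > 0"
    by (auto simp: F_def eventually_at_filter upper_halfplane_def)
  have id: "((\<lambda>z. z) \<longlongrightarrow> x) F" by (simp add: F_def)
  \<comment> \<open>Here \<open>m\<close> stands for one of \<open>z\<close>, \<open>- z\<close>,
    \<open>1 / z\<close>, \<open>- (1 / z)\<close>. It turns the approach to \<open>x\<close> from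
    above into an approach to the real point \<open>m x\<close> within the half-plane of sign
    \<sigma>.\<close>
  have flt: "filterlim m (at (m x) within {w. \<sigma> * Im w > 0}) F"
    if "(m \<longlongrightarrow> m x) F" "\<And>z. Im z > 0 \<Longrightarrow> \<sigma> * Im (m z) > 0" "Im (m x) = 0" for m \<sigma>
    unfolding filterlim_at
  proof
    show "\<forall>\<^sub>F z in F. m z \<in> {w. \<sigma> * Im w > 0} \<and> m z \<noteq> m x"
      by (rule eventually_mono[OF up]) (use that in force)
  qed (rule that(1))
  have limit: "\<exists>L. ((\<lambda>z. exp (log_product \<sigma> I s f (m z))) \<longlongrightarrow> L) F \<and>
      (L \<noteq> 0 \<longleftrightarrow> m x \<in> log_product_domain \<sigma> I s)"
    if h: "\<sigma> = 1 \<or> \<sigma> = -1" "weight_sequence I s f" "(m \<longlongrightarrow> m x) F" "\<And>z. Im z > 0 \<Longrightarrow> \<sigma> * Im (m z) > 0"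
      "Im (m x) = 0" for \<sigma> I s f m
  proof -
    obtain L where L: "((\<lambda>w. exp (log_product \<sigma> I s f w)) \<longlongrightarrow> L) (at (m x) within {w. \<sigma> * Im w > 0})"
      "L \<noteq> 0 \<longleftrightarrow> m x \<in> log_product_domain \<sigma> I s"
      using exp_log_product_limit[OF h(1,2,5)] by blast
    show ?thesis using filterlim_compose[OF L(1) flt[OF h(3-5)]] L(2) by blast
  qed
  note half = upper_half_plane_moebius
  have Im_inv: "Im (1 / x) = 0" using x by (simp add: Im_divide)
  have inv: "((\<lambda>z. 1 / z) \<longlongrightarrow> 1 / x) F" using id x by (intro tendsto_intros) auto
  obtain La where La: "((\<lambda>z. exp (log_product 1 Ia a \<kappa> z)) \<longlongrightarrow> La) F"
    "La \<noteq> 0 \<longleftrightarrow> x \<in> log_product_domain 1 Ia a"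
    using limit[OF _ ws(1) id half(4)] x by auto
  obtain Lb where Lb: "((\<lambda>z. exp (log_product (- 1) Ib b l (- z))) \<longlongrightarrow> Lb) F"
    "Lb \<noteq> 0 \<longleftrightarrow> - x \<in> log_product_domain (- 1) Ib b"
    using limit[OF _ ws(2) tendsto_minus[OF id] half(1)] x by auto
  obtain Lc where Lc: "((\<lambda>z. exp (log_product (- 1) Ic c \<kappa>' (1 / z))) \<longlongrightarrow> Lc) F"
    "Lc \<noteq> 0 \<longleftrightarrow> 1 / x \<in> log_product_domain (- 1) Ic c"
    using limit[OF _ ws(3) inv half(2)] Im_inv by auto
  obtain Ld where Ld: "((\<lambda>z. exp (log_product 1 Id d l' (- (1 / z)))) \<longlongrightarrow> Ld) F"
    "Ld \<noteq> 0 \<longleftrightarrow> - (1 / x) \<in> log_product_domain 1 Id d"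
    using limit[OF _ ws(4) tendsto_minus[OF inv] half(3)] Im_inv by auto
  define e where "e z = exp ((of_real A * z + C + of_real A0 / z) + of_real B * slit_Ln 1 z)" for z
  have Re: "Re x \<noteq> 0" using x by (auto simp: complex_eq_iff)
  have "isCont (slit_Ln 1) x"
    using has_field_derivative_slit_Ln[of 1 x] Re DERIV_isCont by blast
  then have "(slit_Ln 1 \<longlongrightarrow> slit_Ln 1 x) F"
    by (auto simp: isCont_def F_def intro: tendsto_within_subset)
  then have e: "(e \<longlongrightarrow> e x) F"
    unfolding e_def by (intro tendsto_intros id) (use x in auto)
  \<comment> \<open>With the denominators cleared, both sides have finite limits even at a possible
    pole.\<close>
  have "((\<lambda>z. W z * exp (log_product (- 1) Ib b l (- z)) * exp (log_product 1 Id d l' (- (1 / z))))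
      \<longlongrightarrow> \<alpha> * Lb * Ld) F"
    using lim by (intro tendsto_mult Lb Ld) (simp add: F_def)
  moreover have "\<forall>\<^sub>F z in F.
      W z * exp (log_product (- 1) Ib b l (- z)) * exp (log_product 1 Id d l' (- (1 / z))) =
      e z * exp (log_product 1 Ia a \<kappa> z) * exp (log_product (- 1) Ic c \<kappa>' (1 / z))"
    by (rule eventually_mono[OF up]) (simp add: W e_def log_W_def exp_add[symmetric] add_ac)
  ultimately have "((\<lambda>z. e z * exp (log_product 1 Ia a \<kappa> z) * exp (log_product (- 1) Ic c \<kappa>' (1 / z)))
      \<longlongrightarrow> \<alpha> * Lb * Ld) F"
    by (rule Lim_transform_eventually)
  moreover have "((\<lambda>z. e z * exp (log_product 1 Ia a \<kappa> z) * exp (log_product (- 1) Ic c \<kappa>' (1 / z)))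
      \<longlongrightarrow> e x * La * Lc) F"
    by (intro tendsto_mult e La Lc)
  ultimately have eq: "\<alpha> * Lb * Ld = e x * La * Lc" using F tendsto_unique by blast
  have Re_inv: "Re (1 / x) = 1 / Re x" using x Re by (simp add: Re_divide power2_eq_square)
  have pos: "p \<in> log_product_domain \<sigma> I s" if "weight_sequence I s f" "Re p > 0" for p \<sigma> I s f
    using that by (force simp: log_product_domain_def weight_sequence_def)
  \<comment> \<open>As all \<open>s n\<close> are positive, a point with positive real part is never
    singular. This settles \<open>La\<close> and \<open>Lc\<close> for \<open>Re x > 0\<close>, and
    \<open>Lb\<close> and \<open>Ld\<close> for \<open>Re x < 0\<close>; \<open>eq\<close> carries
    it over to the other pair.\<close>
  have "La \<noteq> 0 \<and> Lb \<noteq> 0 \<and> Lc \<noteq> 0 \<and> Ld \<noteq> 0"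
  proof (cases "Re x > 0")
    case True
    then have "La \<noteq> 0" "Lc \<noteq> 0" using La Lc pos ws Re_inv by auto
    then show ?thesis using eq by (auto simp: e_def)
  next
    case False
    then have "- Re x > 0" using Re by auto
    then have "Lb \<noteq> 0" "Ld \<noteq> 0" using Lb Ld pos ws Re_inv by auto
    then show ?thesis using eq \<open>\<alpha> \<noteq> 0\<close> by (auto simp: e_def)
  qed
  then show ?thesis using La Lb Lc Ld Re by (simp add: W_domain_def)
qed

section \<open>Order of the zeros of the logarithmic derivative, and multiplicities\<close>

text \<open>
  A zero of order at least 2 would make the argument of \<^const>\<open>zdlog_W\<close> sweep at least \<open>2 * pi\<close>
  along small half-circles in the upper half-plane, against \<open>Im_zdlog_W_pos\<close>.
\<close>

lemma deriv_zdlog_W_real_zero: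
  assumes x: "x \<in> W_domain" "Im x = 0" "zdlog_W x = 0"
  shows "deriv zdlog_W x \<noteq> 0"
proof -
  obtain R where R: "R > 0" "ball x R \<subseteq> W_domain"
    using open_W_domain x(1) open_contains_ball by blast
  have hol: "zdlog_W holomorphic_on ball x R"
    using holomorphic_zdlog_W R(2) holomorphic_on_subset by blast
  have xR: "x \<in> ball x R" using R by simp
  \<comment> \<open>A constant value would be 0, against the positive imaginary part just above
    \<open>x\<close>.\<close>
  have nonconst: "\<not> zdlog_W constant_on ball x R"
  proof
    assume "zdlog_W constant_on ball x R"
    moreover have "x + \<i> * of_real (R / 2) \<in> ball x R" "x \<in> ball x R"
      using R by (auto simp: dist_norm norm_mult)
    ultimately have "zdlog_W (x + \<i> * of_real (R / 2)) = 0"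
      using x(3) unfolding constant_on_def by metis
    then show False using Im_zdlog_W_pos[of "x + \<i> * of_real (R / 2)"] x R by simp
  qed
  then obtain q r n where q: "0 < n" "0 < r" "ball x r \<subseteq> ball x R" "q holomorphic_on ball x r"
      "\<And>w. w \<in> ball x r \<Longrightarrow> zdlog_W w = (w - x) ^ n * q w"
      "\<And>w. w \<in> ball x r \<Longrightarrow> q w \<noteq> 0"
    using holomorphic_factor_zero_nonconstant[OF hol open_ball connected_ball xR x(3) nonconst] by metis
  have xr: "x \<in> ball x r" using q by simp
  have qc: "isCont q x"
    using q(4) xr holomorphic_on_imp_continuous_on continuous_on_eq_continuous_at open_ball by blast
  \<comment> \<open>On the ray of angle \<theta> from \<open>x\<close>, dividing by
    \<open>t ^ n\<close> and letting \<open>t\<close> tend to 0 leaves the leading coefficient;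
    positivity survives as a weak inequality.\<close>
  have sector: "Im (cis (real n * \<theta>) * q x) \<ge> 0" if \<theta>: "0 < \<theta>" "\<theta> < pi" for \<theta>
  proof (rule tendsto_lowerbound)
    have "((\<lambda>t. x + of_real t * cis \<theta>) \<longlongrightarrow> x + of_real 0 * cis \<theta>) (at_right 0)"
      by (intro tendsto_intros)
    then have "((\<lambda>t. q (x + of_real t * cis \<theta>)) \<longlongrightarrow> q x) (at_right 0)"
      by (intro isCont_tendsto_compose[OF qc]) simp
    then show "((\<lambda>t. Im (cis (real n * \<theta>) * q (x + of_real t * cis \<theta>))) \<longlongrightarrow> Im (cis (real n * \<theta>) * q x))
        (at_right 0)"
      by (intro tendsto_Im tendsto_mult tendsto_const)
    have "\<forall>\<^sub>F t in at_right 0. 0 < t \<and> t < r"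
      using eventually_at_right_real[OF q(2)] by simp
    then show "\<forall>\<^sub>F t in at_right 0. 0 \<le> Im (cis (real n * \<theta>) * q (x + of_real t * cis \<theta>))"
    proof (rule eventually_mono)
      fix t assume t: "0 < t \<and> t < r"
      let ?w = "x + of_real t * cis \<theta>"
      have "Im ?w > 0" using t \<theta> x by (simp add: sin_gt_zero)
      then have "Im (zdlog_W ?w) > 0" by (rule Im_zdlog_W_pos)
      moreover have "zdlog_W ?w = of_real (t ^ n) * (cis (real n * \<theta>) * q ?w)"
        using t q(5)[of ?w] by (simp add: dist_norm norm_mult power_mult_distrib Complex.DeMoivre)
      ultimately have "t ^ n * Im (cis (real n * \<theta>) * q ?w) > 0" by simp
      then show "0 \<le> Im (cis (real n * \<theta>) * q ?w)"
        using t by (simp add: zero_less_mult_iff)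
    qed
  qed simp
  have "n = 1"
  proof (rule ccontr)
    assume "n \<noteq> 1"
    then have n: "n \<ge> 2" using q(1) by simp
    \<comment> \<open>For \<open>n \<ge> 2\<close> the angles \<open>n * \<theta>\<close> with
      \<open>0 < \<theta> < pi\<close> cover the whole open interval from 0 to
      \<open>2 * pi\<close>.\<close>
    have s: "Im (cis t * q x) \<ge> 0" if "0 < t" "t < 2 * pi" for t
    proof -
      have "2 * pi \<le> real n * pi" using n by (intro mult_right_mono) auto
      then have "t < real n * pi" using that by linarith
      then have "t / n < pi" using q(1) by (simp add: field_simps)
      then show ?thesis using sector[of "t / n"] that q(1) by simp
    qed
    have "cis (3 * pi / 2) = - \<i>"
      using cis_divide[of "2 * pi" "pi / 2"] cis_2pi by (simp add: field_simps)
    then have "Re (q x) \<le> 0" using s[of "3 * pi / 2"] by simp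
    moreover have "Re (q x) \<ge> 0" using s[of "pi / 2"] by simp
    moreover have "Im (q x) \<le> 0" using s[of pi] by simp
    moreover have "sqrt 2 / 2 * (Re (q x) + Im (q x)) \<ge> 0"
      using s[of "pi / 4"] by (simp add: cos_45 sin_45 algebra_simps)
    then have "Re (q x) + Im (q x) \<ge> 0" by (simp add: zero_le_mult_iff)
    ultimately have "q x = 0" by (simp add: complex_eq_iff)
    then show False using q(6) xr by blast
  qed
  have "(q has_field_derivative deriv q x) (at x)"
    using q(4) xr open_ball holomorphic_derivI by blast
  then have "((\<lambda>w. (w - x) * q w) has_field_derivative q x) (at x)"
    by (auto intro!: derivative_eq_intros)
  then have "(zdlog_W has_field_derivative q x) (at x)"
    by (rule has_field_derivative_transform_within_open[OF _ open_ball xr])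
       (use q(5) \<open>n = 1\<close> in simp)
  then show ?thesis using q(6)[OF xr] DERIV_imp_deriv by metis
qed

text \<open>The continuation is \<open>g = exp \<circ> log_W\<close>, with
  \<open>g' = g * zdlog_W / z\<close> throughout the domain. At a zero of \<open>zdlog_W\<close> the
  second derivative is therefore \<open>g * deriv zdlog_W / z\<close>.\<close>

lemma
  assumes W: "\<And>z. Im z > 0 \<Longrightarrow> W z = exp (log_W z)"
    and p: "p \<in> W_domain" "exp (log_W p) = \<alpha>"
  shows simple_point: "zdlog_W p \<noteq> 0 \<Longrightarrow> point_of_multiplicity W \<alpha> p 1"
    and double_point:
      "zdlog_W p = 0 \<Longrightarrow> deriv zdlog_W p \<noteq> 0 \<Longrightarrow> point_of_multiplicity W \<alpha> p 2"
proof -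
  define g where "g z = exp (log_W z)" for z
  obtain r where r: "r > 0" "ball p r \<subseteq> W_domain"
    using open_W_domain p(1) open_contains_ball by blast
  have hol: "g holomorphic_on ball p r"
    unfolding g_def using holomorphic_log_W r(2) holomorphic_on_subset
    by (intro holomorphic_intros) blast
  have gW: "\<forall>w \<in> ball p r \<inter> upper_halfplane. g w = W w"
    by (simp add: g_def W upper_halfplane_def)
  have p0: "p \<noteq> 0" using p(1) by (auto simp: W_domain_def)
  have der: "deriv g z = g z * (zdlog_W z / z)" if "z \<in> W_domain" for z
    unfolding g_def
    by (rule DERIV_imp_deriv)
       (use has_field_derivative_log_W[OF that] in \<open>auto intro!: derivative_eq_intros\<close>)
  show "point_of_multiplicity W \<alpha> p 1" if "zdlog_W p \<noteq> 0"
    unfolding point_of_multiplicity_def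
    by (intro conjI exI[of _ g] exI[of _ r]) (use r hol gW p p0 der[OF p(1)] that in \<open>auto simp: g_def\<close>)
  show "point_of_multiplicity W \<alpha> p 2" if z: "zdlog_W p = 0" "deriv zdlog_W p \<noteq> 0"
  proof -
    have "(zdlog_W has_field_derivative deriv zdlog_W p) (at p)"
      using holomorphic_zdlog_W open_W_domain p(1) holomorphic_derivI by blast
    moreover have "(g has_field_derivative deriv g p) (at p)"
      using hol r(1) holomorphic_derivI[OF hol open_ball] by simp
    ultimately have "((\<lambda>z. g z * (zdlog_W z / z)) has_field_derivative g p * (deriv zdlog_W p / p)) (at p)"
      using p0 z(1) by (auto intro!: derivative_eq_intros)
    then have "(deriv g has_field_derivative g p * (deriv zdlog_W p / p)) (at p)"
      by (rule has_field_derivative_transform_within_open[OF _ open_W_domain p(1)]) (simp add: der)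
    then have "deriv (deriv g) p \<noteq> 0"
      using p0 z(2) by (auto simp: g_def dest!: DERIV_imp_deriv)
    moreover have "deriv g p = 0" using der[OF p(1)] z by simp
    moreover have "{1..<2::nat} = {1}" by auto
    ultimately show ?thesis
      unfolding point_of_multiplicity_def
      by (intro conjI exI[of _ g] exI[of _ r]) (use r hol gW p in \<open>auto simp: g_def numeral_2_eq_2\<close>)
  qed
qed

text \<open>By continuity of \<open>log_W\<close> at \<open>x\<close> and uniqueness of limits,
  \<alpha> is the value of the continuation. Whether \<open>zdlog_W\<close> vanishes at
  \<open>x\<close> then decides between the two cases.\<close>

lemma real_point_simple_or_double:
  assumes W: "\<And>z. Im z > 0 \<Longrightarrow> W z = exp (log_W z)"
    and x: "x \<noteq> 0" "Im x = 0" and lim: "(W \<longlongrightarrow> \<alpha>) (at x within upper_halfplane)" and "\<alpha> \<noteq> 0"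
  shows "point_of_multiplicity W \<alpha> x 1 \<or> point_of_multiplicity W \<alpha> x 2"
proof -
  have xD: "x \<in> W_domain" by (rule real_point_in_W_domain[OF assms])
  then have "isCont log_W x" using has_field_derivative_log_W DERIV_isCont by blast
  then have "((\<lambda>z. exp (log_W z)) \<longlongrightarrow> exp (log_W x)) (at x within upper_halfplane)"
    by (intro tendsto_exp) (auto simp: isCont_def intro: tendsto_within_subset)
  moreover have "\<forall>\<^sub>F z in at x within upper_halfplane. exp (log_W z) = W z"
    by (auto simp: eventually_at_filter upper_halfplane_def W)
  ultimately have "(W \<longlongrightarrow> exp (log_W x)) (at x within upper_halfplane)"
    by (rule Lim_transform_eventually)
  then have "exp (log_W x) = \<alpha>"
    using tendsto_unique[OF real_point_upper_halfplane_nontrivial[OF x(2)] _ lim] by blast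
  then show ?thesis
    using simple_point[OF W xD] double_point[OF W xD] deriv_zdlog_W_real_zero[OF xD x(2)] by blast
qed

end

theorem theorem11:
  fixes W :: "complex \<Rightarrow> complex"
    and A A0 B :: real and C \<alpha> :: complex
    and Na Nb Nc Nd :: enat
    and a b c d \<kappa> l \<kappa>' l' :: "nat \<Rightarrow> real"
  assumes "A \<ge> 0" and "A0 \<ge> 0"
    and "admissible Na a \<kappa>"
    and "admissible Nb b l"
    and "admissible Nc c \<kappa>'"
    and "admissible Nd d l'"
    and "\<And>z. z \<in> upper_halfplane \<Longrightarrow>
           W z = W_formula A A0 B C Na a \<kappa> Nb b l Nc c \<kappa>' Nd d l' z"
    and "\<exists>z \<in> upper_halfplane. W z \<noteq> exp C * z powr of_real B"
    and "\<alpha> \<noteq> 0"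
  shows "(\<forall>z. Im z > 0 \<and> takes_value W z \<alpha> \<longrightarrow>
            point_of_multiplicity W \<alpha> z 1 \<and>
            (\<forall>w v. Im w \<ge> 0 \<and> takes_value W w v \<and> norm v = norm \<alpha> \<and> w \<noteq> z \<longrightarrow> norm w \<noteq> norm z))
       \<and> (\<forall>x :: real. x \<noteq> 0 \<and> takes_value W (of_real x) \<alpha> \<longrightarrow>
            point_of_multiplicity W \<alpha> (of_real x) 1 \<or> point_of_multiplicity W \<alpha> (of_real x) 2)"
proof -
  define I where "I N = {n. enat n < N}" for N
  \<comment> \<open>Otherwise every product is empty and the formula collapses to
    \<open>exp C * z powr B\<close>, which the hypothesis excludes.\<close>
  have nontrivial: "A \<noteq> 0 \<or> A0 \<noteq> 0 \<or> I Na \<noteq> {} \<or> I Nb \<noteq> {} \<or> I Nc \<noteq> {} \<or> I Nd \<noteq> {}"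
  proof (rule ccontr)
    assume triv: "\<not> ?thesis"
    then have "power_product N s e w = 1" if "N \<in> {Na, Nb, Nc, Nd}" for N s e w
      using that by (auto simp: power_product_def I_def)
    then have "W_formula A A0 B C Na a \<kappa> Nb b l Nc c \<kappa>' Nd d l' z = exp C * z powr of_real B" for z
      using triv by (simp add: W_formula_def)
    then show False using assms(7,8) by auto
  qed
  interpret power_product_data A A0 B C "I Na" "I Nb" "I Nc" "I Nd" a b c d \<kappa> l \<kappa>' l'
    using assms nontrivial admissible_imp_weight_sequence by unfold_locales (auto simp: I_def)
  \<comment> \<open>For \<open>Im z > 0\<close> every principal power in the formula is the
    exponential of the corresponding slit logarithm.\<close>
  have W: "W z = exp (log_W z)" if z: "Im z > 0" for z
  proof -
    note half = upper_half_plane_moebius[OF z]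
    have "z powr of_real B = exp (of_real B * slit_Ln 1 z)"
      using z slit_Ln_eq_Ln[of 1 z] by (auto simp: powr_def)
    moreover have "power_product Na a \<kappa> z = exp (log_product 1 (I Na) a \<kappa> z)"
      using power_product_eq_exp[OF _ ws(1)[unfolded I_def] half(4)] by (simp add: I_def)
    moreover have "power_product Nb b l (- z) = exp (log_product (- 1) (I Nb) b l (- z))"
      using power_product_eq_exp[OF _ ws(2)[unfolded I_def] half(1)] by (simp add: I_def)
    moreover have "power_product Nc c \<kappa>' (1 / z) = exp (log_product (- 1) (I Nc) c \<kappa>' (1 / z))"
      using power_product_eq_exp[OF _ ws(3)[unfolded I_def] half(2)] by (simp add: I_def)
    moreover have "power_product Nd d l' (- (1 / z)) = exp (log_product 1 (I Nd) d l' (- (1 / z)))"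
      using power_product_eq_exp[OF _ ws(4)[unfolded I_def] half(3)] by (simp add: I_def)
    ultimately show ?thesis
      using assms(7)[of z] z
      by (simp only: W_formula_def log_W_def exp_add exp_diff) (simp add: upper_halfplane_def)
  qed
  show ?thesis
  proof (intro conjI allI impI; (elim conjE)?)
    fix z assume z: "Im z > 0" "takes_value W z \<alpha>"
    then have \<alpha>: "W z = \<alpha>" by (auto simp: takes_value_def)
    show "point_of_multiplicity W \<alpha> z 1"
      using simple_point[OF W half_plane_subset_W_domain[OF z(1)]] W[OF z(1)] \<alpha> Im_zdlog_W_pos[OF z(1)] by force
    fix w v assume "0 \<le> Im w" "takes_value W w v" "norm v = norm \<alpha>" "w \<noteq> z"
    then show "norm w \<noteq> norm z" using norm_distinct_on_circle[OF W z(1), of w v] \<alpha> by auto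
  next
    fix x :: real assume x: "x \<noteq> 0" "takes_value W (of_real x) \<alpha>"
    then show "point_of_multiplicity W \<alpha> (of_real x) 1 \<or> point_of_multiplicity W \<alpha> (of_real x) 2"
      using real_point_simple_or_double[OF W, of "of_real x" \<alpha>] \<open>\<alpha> \<noteq> 0\<close> by (auto simp: takes_value_def)
  qed
qed

end
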